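(* Let $\mathbb{K}$ be a field, $\lambda\in\mathbb{K}$, $\ell\ge1$, let $k_1,\dots,k_\ell$ and $r_1>\cdots>r_\ell$ be positive integers, and let $J_\lambda=\bigoplus_{i=1}^\ell k_iJ_{\lambda,r_i}$. Let $I_\lambda\subseteq R$ be the ideal generated by the $2\times2$ minors of $(J_\lambda\boldsymbol{x}\mid\boldsymbol{x})$, and for $j\in\{1,\dots,\ell\}$ let $\mathfrak{q}_{\lambda,j}=I_\lambda+I_j$ with $I_j$ as in the context. Then $$I_\lambda=\bigcap_{j=1}^\ell\mathfrak{q}_{\lambda,j}.$$
   Context: $J_{\lambda,r}$ denotes the $r\times r$ Jordan block with $\lambda$ on the diagonal and $1$ on the superdiagonal; $kJ_{\lambda,r}$ is the direct sum (block diagonal matrix) of $k$ copies of $J_{\lambda,r}$. The rows of $J_\lambda$ are indexed by $\Lambda=\{(i_1,i_2,i_3): 1\le i_1\le\ell,\ 1\le i_2\le k_{i_1},\ 1\le i_3\le r_{i_1}\}$ in lexicographically increasing order: $(i_1,i_2,i_3)$ is the $i_3$-th row of the $i_2$-th copy of $J_{\lambda,r_{i_1}}$. $R=\mathbb{K}[x(\boldsymbol{i}):\boldsymbol{i}\in\Lambda]$, and $\boldsymbol{x}$ is the column vector of the variables in this order. $(J_\lambda\boldsymbol{x}\mid\boldsymbol{x})$ is the two-column matrix with columns $J_\lambda\boldsymbol{x}$ and $\boldsymbol{x}$. For $j\in\{1,\dots,\ell\}$: $\Lambda_{j,1}=\{(i_1,i_2,i_3)\in\Lambda: i_1\le j,\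 r_j+1\le i_3\le r_{i_1}\}$, $\Lambda_{j,2}=\{(i_1,i_2,i_3)\in\Lambda: i_1>j\}$, and $I_j=\langle x(\boldsymbol{i}):\boldsymbol{i}\in\Lambda_{j,1}\cup\Lambda_{j,2}\rangle$ (the zero ideal if the index set is empty). *)

theory Defs
  imports
    "HOL-Library.Poly_Mapping"
    "HOL-Algebra.Ideal"
    "Jordan_Normal_Form.Jordan_Normal_Form"
    "Jordan_Normal_Form.DL_Submatrix"
begin

text \<open>
  A monomial in variables of type \<open>'v\<close> is a finitely supported exponent function
  \<open>'v \<Rightarrow>\<^sub>0 nat\<close>, and a polynomial is a finitely supported function from monomials to coefficients.
\<close>

type_synonym ('v, 'a) mpol = "('v \<Rightarrow>\<^sub>0 nat) \<Rightarrow>\<^sub>0 'a"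

definition mpol_const :: "'a::zero \<Rightarrow> ('v, 'a) mpol" where
  "mpol_const c = Poly_Mapping.single 0 c"

definition mpol_var :: "'v \<Rightarrow> ('v, 'a::{zero,one}) mpol" where
  "mpol_var v = Poly_Mapping.single (Poly_Mapping.single v 1) 1"

text \<open>The ring of polynomials in the variables from \<open>V\<close> only.\<close>

definition mpol_ring :: "'v set \<Rightarrow> ('v, 'a::comm_ring_1) mpol ring" where
  "mpol_ring V = \<lparr>carrier = {p. \<forall>m \<in> Poly_Mapping.keys p. Poly_Mapping.keys m \<subseteq> V},
                  monoid.mult = (*), one = 1, zero = 0, add = (+)\<rparr>"

definition minors :: "nat \<Rightarrow> 'a::comm_ring_1 mat \<Rightarrow> 'a set" where
  "minors n A = {det (submatrix A I J) | I J.
     I \<subseteq> {..<dim_row A} \<and> J \<subseteq> {..<dim_col A} \<and> card I = n \<and> card J = n}"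

text \<open>
  The parameters \<open>l\<close>, \<open>k\<close>, \<open>r\<close> are the number of distinct block sizes, the multiplicities
  \<open>k 1, \<dots>, k l\<close> and the block sizes \<open>r 1, \<dots>, r l\<close>; values of \<open>k\<close> and \<open>r\<close> outside
  \<open>{1..l}\<close> are irrelevant.
\<close>

type_synonym index = "nat \<times> nat \<times> nat"

definition Lambda :: "nat \<Rightarrow> (nat \<Rightarrow> nat) \<Rightarrow> (nat \<Rightarrow> nat) \<Rightarrow> index set" where
  "Lambda l k r = {(i1, i2, i3). 1 \<le> i1 \<and> i1 \<le> l \<and> 1 \<le> i2 \<and> i2 \<le> k i1 \<and> 1 \<le> i3 \<and> i3 \<le> r i1}"

definition Lambda1 :: "nat \<Rightarrow> (nat \<Rightarrow> nat) \<Rightarrow> (nat \<Rightarrow> nat) \<Rightarrow> nat \<Rightarrow> index set" where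
  "Lambda1 l k r j = {(i1, i2, i3) \<in> Lambda l k r. i1 \<le> j \<and> r j + 1 \<le> i3 \<and> i3 \<le> r i1}"

definition Lambda2 :: "nat \<Rightarrow> (nat \<Rightarrow> nat) \<Rightarrow> (nat \<Rightarrow> nat) \<Rightarrow> nat \<Rightarrow> index set" where
  "Lambda2 l k r j = {(i1, i2, i3) \<in> Lambda l k r. i1 > j}"

definition Lambda_list :: "nat \<Rightarrow> (nat \<Rightarrow> nat) \<Rightarrow> (nat \<Rightarrow> nat) \<Rightarrow> index list" where
  "Lambda_list l k r =
     [(i1, i2, i3). i1 \<leftarrow> [1..<Suc l], i2 \<leftarrow> [1..<Suc (k i1)], i3 \<leftarrow> [1..<Suc (r i1)]]"

lemma set_Lambda_list: "set (Lambda_list l k r) = Lambda l k r"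
  unfolding Lambda_list_def Lambda_def by (auto simp: image_iff)

lemma sorted_wrt_concat_map:
  assumes "sorted_wrt Q xs" "\<And>x. x \<in> set xs \<Longrightarrow> sorted_wrt P (f x)"
    and "\<And>x y a b. Q x y \<Longrightarrow> a \<in> set (f x) \<Longrightarrow> b \<in> set (f y) \<Longrightarrow> P a b"
  shows "sorted_wrt P (concat (map f xs))"
  using assms(1,2) by (induction xs) (auto simp: sorted_wrt_append intro: assms(3))

lemma Lambda_list_lexicographic:
  "sorted_wrt (\<lambda>(a1, a2, a3) (b1, b2, b3).
      a1 < b1 \<or> a1 = b1 \<and> (a2 < b2 \<or> a2 = b2 \<and> a3 < b3)) (Lambda_list l k r)"
  unfolding Lambda_list_def
  by (intro sorted_wrt_concat_map[where Q = "(<)"])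
     (auto simp: sorted_wrt_map simp del: upt_Suc intro!: sorted_wrt_concat_map[where Q = "(<)"])

definition J_mat :: "'a::{zero,one} \<Rightarrow> nat \<Rightarrow> (nat \<Rightarrow> nat) \<Rightarrow> (nat \<Rightarrow> nat) \<Rightarrow> 'a mat" where
  "J_mat lam l k r = jordan_matrix (concat (map (\<lambda>i. replicate (k i) (r i, lam)) [1..<Suc l]))"

definition x_vec :: "nat \<Rightarrow> (nat \<Rightarrow> nat) \<Rightarrow> (nat \<Rightarrow> nat) \<Rightarrow> (index, 'a::comm_ring_1) mpol vec" where
  "x_vec l k r = vec_of_list (map mpol_var (Lambda_list l k r))"

lemma length_Lambda_list: "length (Lambda_list l k r) = (\<Sum>i\<leftarrow>[1..<Suc l]. k i * r i)"
  unfolding Lambda_list_def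
  by (simp add: length_concat sum_list_triv comp_def del: upt_Suc)

lemma dim_J_mat:
  "dim_row (J_mat lam l k r) = length (Lambda_list l k r)"
  "dim_col (J_mat lam l k r) = length (Lambda_list l k r)"
proof -
  have "sum_list (concat (map (\<lambda>i. replicate (k i) (r i)) xs)) = (\<Sum>i\<leftarrow>xs. k i * r i)" for xs
    by (induction xs) (simp_all add: sum_list_replicate)
  then show "dim_row (J_mat lam l k r) = length (Lambda_list l k r)"
    "dim_col (J_mat lam l k r) = length (Lambda_list l k r)"
    by (simp_all add: J_mat_def length_Lambda_list map_concat comp_def del: upt_Suc)
qed

text \<open>The matrix \<open>(J x | x)\<close>; the entries of \<open>J\<close> are embedded as constant polynomials.\<close>

definition Jx_x :: "'a::comm_ring_1 \<Rightarrow> nat \<Rightarrow> (nat \<Rightarrow> nat) \<Rightarrow> (nat \<Rightarrow> nat) \<Rightarrow> (index, 'a) mpol mat" where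
  "Jx_x lam l k r =
     mat_of_cols (dim_vec (x_vec l k r :: (index, 'a) mpol vec))
       [map_mat mpol_const (J_mat lam l k r) *\<^sub>v x_vec l k r, x_vec l k r]"

abbreviation R_ring :: "nat \<Rightarrow> (nat \<Rightarrow> nat) \<Rightarrow> (nat \<Rightarrow> nat) \<Rightarrow> (index, 'a::comm_ring_1) mpol ring" where
  "R_ring l k r \<equiv> mpol_ring (Lambda l k r)"

definition I_minors ::
    "'a::comm_ring_1 \<Rightarrow> nat \<Rightarrow> (nat \<Rightarrow> nat) \<Rightarrow> (nat \<Rightarrow> nat) \<Rightarrow> (index, 'a) mpol set" where
  "I_minors lam l k r = genideal (R_ring l k r) (minors 2 (Jx_x lam l k r))"

definition I_vars ::
    "nat \<Rightarrow> (nat \<Rightarrow> nat) \<Rightarrow> (nat \<Rightarrow> nat) \<Rightarrow> nat \<Rightarrow> (index, 'a::comm_ring_1) mpol set" where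
  "I_vars l k r j = genideal (R_ring l k r) (mpol_var ` (Lambda1 l k r j \<union> Lambda2 l k r j))"

definition q_ideal ::
    "'a::comm_ring_1 \<Rightarrow> nat \<Rightarrow> (nat \<Rightarrow> nat) \<Rightarrow> (nat \<Rightarrow> nat) \<Rightarrow> nat \<Rightarrow> (index, 'a) mpol set" where
  "q_ideal lam l k r j = I_minors lam l k r <+>\<^bsub>R_ring l k r\<^esub> I_vars l k r j"

text \<open>
  \<^const>\<open>genideal\<close> is only meaningful for generators inside the carrier of a ring; the following
  facts guarantee this for \<^const>\<open>I_minors\<close> and \<^const>\<open>I_vars\<close>.
\<close>

lemma mpol_ring_simps:
  "p \<in> carrier (mpol_ring V) \<longleftrightarrow> (\<forall>m \<in> Poly_Mapping.keys p. Poly_Mapping.keys m \<subseteq> V)"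
  "p \<otimes>\<^bsub>mpol_ring V\<^esub> q = p * q" "p \<oplus>\<^bsub>mpol_ring V\<^esub> q = p + q"
  "\<one>\<^bsub>mpol_ring V\<^esub> = 1" "\<zero>\<^bsub>mpol_ring V\<^esub> = 0"
  by (simp_all add: mpol_ring_def)

lemma mpol_carrier_intros:
  shows mpol_carrier_zero: "0 \<in> carrier (mpol_ring V)"
    and mpol_carrier_one: "1 \<in> carrier (mpol_ring V)"
    and mpol_carrier_add:
      "p \<in> carrier (mpol_ring V) \<Longrightarrow> q \<in> carrier (mpol_ring V) \<Longrightarrow> p + q \<in> carrier (mpol_ring V)"
    and mpol_carrier_uminus: "p \<in> carrier (mpol_ring V) \<Longrightarrow> - p \<in> carrier (mpol_ring V)"
    and mpol_carrier_mult:
      "p \<in> carrier (mpol_ring V) \<Longrightarrow> q \<in> carrier (mpol_ring V) \<Longrightarrow> p * q \<in> carrier (mpol_ring V)"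
    and mpol_carrier_const: "mpol_const c \<in> carrier (mpol_ring V)"
    and mpol_carrier_var: "v \<in> V \<Longrightarrow> mpol_var v \<in> carrier (mpol_ring V)"
proof -
  show "p + q \<in> carrier (mpol_ring V)"
    if "p \<in> carrier (mpol_ring V)" "q \<in> carrier (mpol_ring V)"
    using that Poly_Mapping.keys_add[of p q] by (auto simp: mpol_ring_simps)
  show "p * q \<in> carrier (mpol_ring V)"
    if pq: "p \<in> carrier (mpol_ring V)" "q \<in> carrier (mpol_ring V)"
  proof -
    have "Poly_Mapping.keys m \<subseteq> V" if m: "m \<in> Poly_Mapping.keys (p * q)" for m
    proof -
      obtain a b where ab: "a \<in> Poly_Mapping.keys p" "b \<in> Poly_Mapping.keys q" "m = a + b"
        using m keys_mult[of p q] by auto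
      then have "Poly_Mapping.keys a \<subseteq> V" "Poly_Mapping.keys b \<subseteq> V"
        using pq by (simp_all add: mpol_ring_simps)
      then show ?thesis using ab Poly_Mapping.keys_add[of a b] by blast
    qed
    then show ?thesis by (simp add: mpol_ring_simps)
  qed
qed (auto simp: mpol_ring_simps mpol_const_def mpol_var_def split: if_splits)

lemma cring_mpol_ring: "cring (mpol_ring V :: ('v, 'a::comm_ring_1) mpol ring)" (is "cring ?R")
proof (rule cringI)
  show "abelian_group ?R"
  proof (rule abelian_groupI)
    fix p assume "p \<in> carrier ?R"
    then show "\<exists>q\<in>carrier ?R. q \<oplus>\<^bsub>?R\<^esub> p = \<zero>\<^bsub>?R\<^esub>"
      by (intro bexI[of _ "- p"]) (simp_all add: mpol_ring_simps(2-) mpol_carrier_intros)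
  qed (simp_all add: mpol_ring_simps(2-) mpol_carrier_intros ac_simps)
  show "comm_monoid ?R"
    by (rule comm_monoidI) (simp_all add: mpol_ring_simps(2-) mpol_carrier_intros ac_simps)
qed (simp add: mpol_ring_simps(2-) distrib_right)

lemma mpol_carrier_sum:
  "(\<And>i. i \<in> A \<Longrightarrow> f i \<in> carrier (mpol_ring V)) \<Longrightarrow> sum f A \<in> carrier (mpol_ring V)"
  by (induction A rule: infinite_finite_induct) (auto simp: mpol_carrier_intros)

lemma mpol_carrier_prod:
  "(\<And>i. i \<in> A \<Longrightarrow> f i \<in> carrier (mpol_ring V)) \<Longrightarrow> prod f A \<in> carrier (mpol_ring V)"
  by (induction A rule: infinite_finite_induct) (auto simp: mpol_carrier_intros)

lemma x_vec_carrier: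
  "i < length (Lambda_list l k r) \<Longrightarrow> x_vec l k r $ i \<in> carrier (R_ring l k r)"
  by (auto simp: x_vec_def vec_of_list_index set_Lambda_list[symmetric] intro!: mpol_carrier_var)

lemma Jx_x_carrier:
  assumes "i < length (Lambda_list l k r)" "j < 2"
  shows "Jx_x lam l k r $$ (i, j) \<in> carrier (R_ring l k r)"
proof -
  have dim: "dim_vec (x_vec l k r :: (index, 'a) mpol vec) = length (Lambda_list l k r)"
    by (simp add: x_vec_def)
  have "(map_mat mpol_const (J_mat lam l k r) *\<^sub>v x_vec l k r) $ i \<in> carrier (R_ring l k r)"
    using assms(1)
    by (auto simp: dim_J_mat dim scalar_prod_def intro!: mpol_carrier_sum mpol_carrier_mult
          mpol_carrier_const x_vec_carrier)
  moreover have "j = 0 \<or> j = 1" using assms(2) by linarith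
  ultimately show ?thesis
    using assms(1) x_vec_carrier[of i l k r] by (auto simp: Jx_x_def mat_of_cols_index dim)
qed

lemma minors_carrier: "minors n (Jx_x lam l k r) \<subseteq> carrier (R_ring l k r)"
proof
  fix p assume "p \<in> minors n (Jx_x lam l k r)"
  then obtain I J where p: "p = det (submatrix (Jx_x lam l k r) I J)" by (auto simp: minors_def)
  let ?S = "submatrix (Jx_x lam l k r) I J"
  have dims: "dim_row (Jx_x lam l k r) = length (Lambda_list l k r)" "dim_col (Jx_x lam l k r) = 2"
    by (simp_all add: Jx_x_def x_vec_def)
  have entry: "?S $$ (a, b) \<in> carrier (R_ring l k r)" if "a < dim_row ?S" "b < dim_col ?S" for a b
    using that
    by (auto simp: dim_submatrix submatrix_index dims intro!: Jx_x_carrier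
          intro: pick_le[of _ "length (Lambda_list l k r)"] pick_le[of _ 2])
  have "signof s \<in> carrier (R_ring l k r)" for s
    by (auto simp: sign_def intro: mpol_carrier_intros)
  then show "p \<in> carrier (R_ring l k r)"
    unfolding p Determinant.det_def
    by (auto intro!: mpol_carrier_zero mpol_carrier_sum mpol_carrier_mult mpol_carrier_prod entry
          dest: permutes_in_image)
qed

lemma vars_carrier:
  "mpol_var ` (Lambda1 l k r j \<union> Lambda2 l k r j) \<subseteq> carrier (R_ring l k r)"
  by (auto simp: Lambda1_def Lambda2_def intro!: mpol_carrier_var)

end

theory Submission
  imports Defs "HOL-Library.Product_Plus"
begin

text \<open>
  Write \<open>x_c(t)\<close> for the variables of a Jordan chain \<open>c\<close> of length \<open>s_c\<close>, with \<open>x_c(t) = 0\<close> for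
  \<open>t > s_c\<close>. The minors are \<open>x_c(t+1) x_d(u) - x_c(t) x_d(u+1)\<close>, independently of the eigenvalue.
  Give a monomial the type consisting of the multiset \<open>M\<close> of its chains and the weight
  \<open>w = \<Sum>(t - 1)\<close>. Modulo the minors a monomial equals \<open>x_c(1 + w)\<close> times variables \<open>x_d(1)\<close>,
  for any \<open>c \<in> M\<close>. So it depends only on its type, and it vanishes if \<open>s_c \<le> w\<close> for some
  \<open>c \<in> M\<close>. Conversely \<open>x_c(t) \<mapsto> z_c \<omega>^(t-1)\<close> sends the minors to combinations of
  monomials of such overflowing types. Hence a polynomial lies in the minor ideal if and only if its
  coefficients sum to \<open>0\<close> over each type that does not overflow. If \<open>(M, w)\<close> does not overflow and
  \<open>j\<close> is the largest block index in \<open>M\<close>, then no monomial of this type lies in \<open>I_j\<close>, so membership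
  in \<open>\<qq>_j\<close> already forces this sum to vanish.
\<close>

section \<open>Action of the Jordan matrix on the vector of variables\<close>

lemma vec_of_list_append: "vec_of_list (xs @ ys) = vec_of_list xs @\<^sub>v vec_of_list ys"
  by (rule eq_vecI) (auto simp: vec_of_list_index nth_append)

text \<open>Each row has only a diagonal and a superdiagonal entry, and the last row lacks the
  latter, hence the cutoff \<open>t < n\<close>. The map \<open>h\<close> stands for the embedding
  of scalars as constants.\<close>

lemma jordan_block_mult_vec:
  fixes h :: "'a::{zero,one} \<Rightarrow> 'b::comm_ring_1"
  assumes h: "h 0 = 0" "h 1 = 1"
  shows "map_mat h (jordan_block n a) *\<^sub>v vec_of_list (map X [1..<Suc n]) =
    vec_of_list (map (\<lambda>t. h a * X t + (if t < n then X (Suc t) else 0)) [1..<Suc n])"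
proof (rule eq_vecI)
  fix i assume "i < dim_vec (vec_of_list (map (\<lambda>t. h a * X t + (if t < n then X (Suc t) else 0)) [1..<Suc n]))"
  then have i: "i < n" by (simp del: upt_Suc)
  have "(map_mat h (jordan_block n a) *\<^sub>v vec_of_list (map X [1..<Suc n])) $ i =
      (\<Sum>j\<in>{0..<n}. h (jordan_block n a $$ (i, j)) * X (Suc j))"
    using i by (simp add: scalar_prod_def vec_of_list_index del: upt_Suc vec_of_list_map)
  \<comment> \<open>The summation index counts from 0 while \<open>X\<close> counts from 1, so
    column \<open>j\<close> carries \<open>X (Suc j)\<close>.\<close>
  also have "\<dots> = (\<Sum>j\<in>{0..<n}. (if j = i then h a * X (Suc i) else 0) +
      (if j = Suc i then X (Suc (Suc i)) else 0))"
    using i by (intro sum.cong) (auto simp: h)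
  also have "\<dots> = h a * X (Suc i) + (if Suc i < n then X (Suc (Suc i)) else 0)"
    using i by (simp add: sum.distrib)
  finally show "(map_mat h (jordan_block n a) *\<^sub>v vec_of_list (map X [1..<Suc n])) $ i =
      vec_of_list (map (\<lambda>t. h a * X t + (if t < n then X (Suc t) else 0)) [1..<Suc n]) $ i"
    using i by (simp add: vec_of_list_index del: upt_Suc vec_of_list_map)
qed (simp del: upt_Suc)

text \<open>Induction on the list of blocks: the first one splits off as the upper left corner of a
  block diagonal matrix, so the product acts on each chain separately.\<close>

lemma jordan_matrix_mult_vec:
  fixes h :: "'a::{zero,one} \<Rightarrow> 'b::comm_ring_1"
  assumes h: "h 0 = 0" "h 1 = 1"
  shows "map_mat h (jordan_matrix (map (\<lambda>c. (n c, a)) cs)) *\<^sub>v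
      vec_of_list (concat (map (\<lambda>c. map (X c) [1..<Suc (n c)]) cs)) =
    vec_of_list (concat (map (\<lambda>c. map (\<lambda>t. h a * X c t + (if t < n c then X c (Suc t) else 0))
      [1..<Suc (n c)]) cs))"
proof (induction cs)
  case Nil
  show ?case by (rule eq_vecI) (auto simp: jordan_matrix_def)
next
  case (Cons c cs)
  let ?J = "jordan_matrix (map (\<lambda>c. (n c, a)) cs)" and ?m = "sum_list (map n cs)"
  have len: "length (concat (map (\<lambda>c. map (X c) [1..<Suc (n c)]) cs)) = ?m"
    by (simp add: length_concat comp_def del: upt_Suc)
  have J: "?J \<in> carrier_mat ?m ?m"
    using jordan_matrix_carrier[of "map (\<lambda>c. (n c, a)) cs"] by (simp add: comp_def)
  have "map_mat h (jordan_matrix (map (\<lambda>c. (n c, a)) (c # cs))) =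
      four_block_mat (map_mat h (jordan_block (n c) a)) (0\<^sub>m (n c) ?m) (0\<^sub>m ?m (n c)) (map_mat h ?J)"
  proof -
    have "jordan_matrix (map (\<lambda>c. (n c, a)) (c # cs)) =
      four_block_mat (jordan_block (n c) a) (0\<^sub>m (n c) ?m) (0\<^sub>m ?m (n c)) ?J"
      using J by (simp add: jordan_matrix_def Let_def comp_def)
    moreover have "map_mat h (0\<^sub>m u v) = 0\<^sub>m u v" for u v by (rule eq_matI) (simp_all add: h)
    ultimately show ?thesis
      using map_four_block_mat[OF jordan_block_carrier zero_carrier_mat zero_carrier_mat J, where f = h]
      by simp
  qed
  moreover have "vec_of_list (map (X c) [1..<Suc (n c)]) \<in> carrier_vec (n c)"
    by (rule carrier_vecI) (simp del: upt_Suc)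
  moreover have "vec_of_list (concat (map (\<lambda>c. map (X c) [1..<Suc (n c)]) cs)) \<in> carrier_vec ?m"
    by (rule carrier_vecI) (simp only: dim_vec_of_list len)
  ultimately show ?case
    using J by (simp add: vec_of_list_append mult_mat_vec_split Cons.IH
        jordan_block_mult_vec[OF h] del: upt_Suc vec_of_list_map One_nat_def)
qed

text \<open>The pair \<open>c\<close> names a Jordan chain by block index and copy. Continuing the
  chain by 0 past its end lets the last row of a block obey the same formula as the others.\<close>

definition ext_var :: "(nat \<Rightarrow> nat) \<Rightarrow> nat \<times> nat \<Rightarrow> nat \<Rightarrow> (index, 'a::comm_ring_1) mpol" where
  "ext_var r c t = (if t \<le> r (fst c) then mpol_var (fst c, snd c, t) else 0)"

text \<open>The nilpotent part of the Jordan matrix applied to the variables.\<close>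

definition next_var :: "(nat \<Rightarrow> nat) \<Rightarrow> index \<Rightarrow> (index, 'a::comm_ring_1) mpol" where
  "next_var r = (\<lambda>(i1, i2, i3). ext_var r (i1, i2) (Suc i3))"

text \<open>The minor of the rows \<open>u\<close> and \<open>v\<close> once the eigenvalue times
  the second column has been subtracted from the first, which leaves the determinant
  unchanged.\<close>

definition minor_poly :: "(nat \<Rightarrow> nat) \<Rightarrow> index \<Rightarrow> index \<Rightarrow> (index, 'a::comm_ring_1) mpol" where
  "minor_poly r u v = next_var r u * mpol_var v - next_var r v * mpol_var u"

lemma J_mat_mult_x_vec:
  "map_mat mpol_const (J_mat lam l k r) *\<^sub>v x_vec l k r =
    vec_of_list (map (\<lambda>v. mpol_const lam * mpol_var v + next_var r v) (Lambda_list l k r))"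
proof -
  \<comment> \<open>The chains in lexicographic order. Both the list of blocks and the list of
    variables are rewritten over \<open>cs\<close>, so that the formula for general Jordan matrices
    applies.\<close>
  define cs where "cs = concat (map (\<lambda>i. map (Pair i) [1..<Suc (k i)]) [1..<Suc l])"
  have rep: "replicate (k i) z = map (\<lambda>_. z) [1..<Suc (k i)]" for i and z :: "nat \<times> 'a"
    by (rule nth_equalityI) (simp_all del: upt_Suc)
  have J: "J_mat lam l k r = jordan_matrix (map (\<lambda>c. (r (fst c), lam)) cs)"
    unfolding J_mat_def cs_def rep by (simp add: map_concat comp_def del: upt_Suc)
  have L: "Lambda_list l k r = concat (map (\<lambda>c. map (\<lambda>t. (fst c, snd c, t)) [1..<Suc (r (fst c))]) cs)"
  proof -
    have "concat (map f (concat xss)) = concat (map (\<lambda>xs. concat (map f xs)) xss)"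
      for f :: "nat \<times> nat \<Rightarrow> index list" and xss
      by (induction xss) simp_all
    then show ?thesis
      unfolding Lambda_list_def cs_def by (simp add: comp_def del: upt_Suc)
  qed
  have "mpol_const 0 = (0 :: (index, 'a) mpol)" "mpol_const 1 = (1 :: (index, 'a) mpol)"
    by (simp_all add: mpol_const_def)
  from jordan_matrix_mult_vec[where h = mpol_const and n = "\<lambda>c. r (fst c)" and a = lam and cs = cs
      and X = "\<lambda>c t. mpol_var (fst c, snd c, t)", OF this]
  show ?thesis
    unfolding J x_vec_def L
    by (simp add: map_concat comp_def next_var_def ext_var_def Suc_le_eq del: upt_Suc vec_of_list_map
        cong: if_cong)
qed

lemma Jx_x_index:
  assumes "i < length (Lambda_list l k r)"
  shows "Jx_x lam l k r $$ (i, 0) =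
      mpol_const lam * mpol_var (Lambda_list l k r ! i) + next_var r (Lambda_list l k r ! i)"
    and "Jx_x lam l k r $$ (i, 1) = mpol_var (Lambda_list l k r ! i)"
  using assms unfolding Jx_x_def J_mat_mult_x_vec
  by (simp_all add: x_vec_def mat_of_cols_index vec_of_list_index del: vec_of_list_map)

section \<open>The minors in explicit form\<close>

lemma det_2x2:
  assumes "A \<in> carrier_mat 2 2"
  shows "det A = A $$ (0, 0) * A $$ (1, 1) - A $$ (0, 1) * A $$ (1, 0)"
proof -
  have "det A = (\<Sum>i<2. A $$ (i, 0) * cofactor A i 0)"
    using laplace_expansion_column[OF assms, of 0] by simp
  also have "\<dots> = A $$ (0, 0) * A $$ (1, 1) - A $$ (0, 1) * A $$ (1, 0)"
    using assms by (simp add: numeral_2_eq_2 cofactor_def det_single mat_delete_def insert_index_def)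
  finally show ?thesis .
qed

lemma minors_2_two_columns:
  fixes A :: "'a::comm_ring_1 mat"
  assumes A: "dim_col A = 2"
  shows "minors 2 A = {A $$ (i, 0) * A $$ (j, 1) - A $$ (i, 1) * A $$ (j, 0) | i j. i < j \<and> j < dim_row A}"
proof -
  have det: "det (submatrix A {i, j} {..<2}) = A $$ (i, 0) * A $$ (j, 1) - A $$ (i, 1) * A $$ (j, 0)"
    if ij: "i < j" "j < dim_row A" for i j
  proof -
    let ?S = "submatrix A {i, j} {..<2}"
    have "{a. a < dim_row A \<and> a \<in> {i, j}} = {i, j}" "{b. b < dim_col A \<and> b \<in> {..<2::nat}} = {..<2}"
      using ij A by auto
    then have "dim_row ?S = card {i, j}" "dim_col ?S = card {..<2::nat}"
      unfolding dim_submatrix by (simp_all only:)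
    then have "?S \<in> carrier_mat 2 2"
      using ij by (intro carrier_matI) simp_all
    moreover have "?S $$ (0, 0) = A $$ (i, 0)" "?S $$ (0, 1) = A $$ (i, 1)"
      "?S $$ (1, 0) = A $$ (j, 0)" "?S $$ (1, 1) = A $$ (j, 1)"
    proof -
      have "{a \<in> {i, j}. a < i} = {}" "{a \<in> {i, j}. a < j} = {i}"
        "{b \<in> {..<2::nat}. b < 0} = {}" "{b \<in> {..<2::nat}. b < 1} = {0}"
        using ij by auto
      then have card: "card {a \<in> {i, j}. a < i} = 0" "card {a \<in> {i, j}. a < j} = 1"
        "card {b \<in> {..<2::nat}. b < 0} = 0" "card {b \<in> {..<2::nat}. b < 1} = 1"
        by (simp_all only: card.empty card_1_singleton_iff) auto
      \<comment> \<open>A selected row or column sits in the submatrix at the position given by the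
        number of selected ones before it.\<close>
      have "?S $$ (card {a \<in> {i, j}. a < p}, card {b \<in> {..<2::nat}. b < q}) = A $$ (p, q)"
        if "p \<in> {i, j}" "q < 2" for p q
        using that ij A by (intro submatrix_index_card) auto
      from this[of i 0] this[of i 1] this[of j 0] this[of j 1]
      show "?S $$ (0, 0) = A $$ (i, 0)" "?S $$ (0, 1) = A $$ (i, 1)"
        "?S $$ (1, 0) = A $$ (j, 0)" "?S $$ (1, 1) = A $$ (j, 1)"
        unfolding card by auto
    qed
    ultimately show ?thesis by (simp add: det_2x2)
  qed
  have "minors 2 A = {det (submatrix A {i, j} {..<2}) | i j. i < j \<and> j < dim_row A}"
  proof (intro equalityI subsetI)
    fix p assume "p \<in> minors 2 A"
    then obtain I J where p: "p = det (submatrix A I J)" and I: "I \<subseteq> {..<dim_row A}" "card I = 2"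
      and J: "J \<subseteq> {..<2}" "card J = 2"
      unfolding minors_def A by auto
    have "J = {..<2}" using J by (intro card_subset_eq) auto
    moreover obtain i j where "I = {i, j}" "i < j"
      using I(2) unfolding card_2_iff by (metis insert_commute linorder_neqE_nat)
    ultimately show "p \<in> {det (submatrix A {i, j} {..<2}) | i j. i < j \<and> j < dim_row A}"
      using p I by auto
  next
    fix p assume "p \<in> {det (submatrix A {i, j} {..<2}) | i j. i < j \<and> j < dim_row A}"
    then show "p \<in> minors 2 A"
      unfolding minors_def A by force
  qed
  also have "\<dots> = {A $$ (i, 0) * A $$ (j, 1) - A $$ (i, 1) * A $$ (j, 0) | i j. i < j \<and> j < dim_row A}"
    by (intro Collect_cong ex_cong1) (use det in auto)
  finally show ?thesis .
qed

lemma minors_Jx_x: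
  "minors 2 (Jx_x lam l k r) = {minor_poly r (Lambda_list l k r ! i) (Lambda_list l k r ! j) | i j.
    i < j \<and> j < length (Lambda_list l k r)}"
proof -
  have "dim_row (Jx_x lam l k r) = length (Lambda_list l k r)" "dim_col (Jx_x lam l k r) = 2"
    by (simp_all add: Jx_x_def x_vec_def)
  then show ?thesis
    by (subst minors_2_two_columns) (auto simp: Jx_x_index minor_poly_def algebra_simps simp del: One_nat_def
        intro!: Collect_cong ex_cong1)
qed

section \<open>Monomials as multisets, and pushforward of coefficients\<close>

definition mset_of_monom :: "('v \<Rightarrow>\<^sub>0 nat) \<Rightarrow> 'v multiset" where
  "mset_of_monom m = Abs_multiset (Poly_Mapping.lookup m)"

lemma count_mset_of_monom: "count (mset_of_monom m) v = Poly_Mapping.lookup m v"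
  unfolding mset_of_monom_def by (subst count_Abs_multiset) simp_all

lemma set_mset_of_monom: "set_mset (mset_of_monom m) = Poly_Mapping.keys m"
  by (auto simp: count_mset_of_monom in_keys_iff simp flip: count_greater_zero_iff)

lemma mset_of_monom_plus: "mset_of_monom (m + n) = mset_of_monom m + mset_of_monom n"
  by (rule multiset_eqI) (simp add: count_mset_of_monom lookup_add)

lemma mset_of_monom_single: "mset_of_monom (Poly_Mapping.single v 1) = {#v#}"
  by (rule multiset_eqI) (auto simp: count_mset_of_monom lookup_single)

lemma prod_mpol_var:
  "(\<Prod>v\<in>#mset_of_monom m. mpol_var v) = (Poly_Mapping.single m 1 :: ('v, 'a::comm_ring_1) mpol)"
proof -
  have "(\<Prod>v\<in>#A. mpol_var v) =
      (Poly_Mapping.single (\<Sum>v\<in>#A. Poly_Mapping.single v 1) 1 :: ('v, 'a) mpol)" for A :: "'v multiset"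
    by (induction A) (simp_all add: mpol_var_def mult_single)
  moreover have "Poly_Mapping.lookup (\<Sum>v\<in>#A. Poly_Mapping.single v 1) w = count A w"
    for A :: "'v multiset" and w
    by (induction A) (simp_all add: lookup_add lookup_single when_def)
  then have "(\<Sum>v\<in>#mset_of_monom m. Poly_Mapping.single v 1) = m"
    by (intro poly_mapping_eqI) (simp add: count_mset_of_monom)
  ultimately show ?thesis by simp
qed

text \<open>Pushforward along \<open>f\<close>: coefficients are summed over the fibres and may
  cancel. For \<open>f = monom_type\<close> this is the substitution
  \<open>x_c(t) \<mapsto> z_c \<omega>^(t-1)\<close>.\<close>

definition push_keys :: "('m \<Rightarrow> 'n) \<Rightarrow> ('m \<Rightarrow>\<^sub>0 'a::comm_monoid_add) \<Rightarrow> ('n \<Rightarrow>\<^sub>0 'a)" where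
  "push_keys f p = (\<Sum>m\<in>Poly_Mapping.keys p. Poly_Mapping.single (f m) (Poly_Mapping.lookup p m))"

lemma push_keys_zero [simp]: "push_keys f 0 = 0"
  by (simp add: push_keys_def)

lemma push_keys_plus: "push_keys f (p + q) = push_keys f p + push_keys f q"
  unfolding push_keys_def by (rule setsum_keys_plus_distrib) (simp_all add: single_add)

lemma push_keys_diff:
  fixes p q :: "'m \<Rightarrow>\<^sub>0 'a::ab_group_add"
  shows "push_keys f (p - q) = push_keys f p - push_keys f q"
  using push_keys_plus[of f "p - q" q] by (simp add: algebra_simps)

lemma push_keys_sum: "push_keys f (sum p A) = (\<Sum>i\<in>A. push_keys f (p i))"
  by (induction A rule: infinite_finite_induct) (simp_all add: push_keys_plus)

lemma push_keys_single: "push_keys f (Poly_Mapping.single m c) = Poly_Mapping.single (f m) c"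
  by (simp add: push_keys_def)

lemma sum_single_lookup:
  "p = (\<Sum>m\<in>Poly_Mapping.keys p. Poly_Mapping.single m (Poly_Mapping.lookup p m))"
  by (rule poly_mapping_eqI) (auto simp: lookup_sum lookup_single when_def in_keys_iff)

text \<open>Both sides are additive in each factor, so the claim reduces to single terms, where it
  is the additivity of \<open>f\<close>.\<close>

lemma push_keys_mult:
  fixes p q :: "'m::monoid_add \<Rightarrow>\<^sub>0 'a::semiring_0" and f :: "'m \<Rightarrow> 'n::monoid_add"
  assumes "\<And>a b. f (a + b) = f a + f b"
  shows "push_keys f (p * q) = push_keys f p * push_keys f q"
proof -
  have "push_keys f (p * q) =
      push_keys f ((\<Sum>m\<in>Poly_Mapping.keys p. Poly_Mapping.single m (Poly_Mapping.lookup p m)) *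
        (\<Sum>m\<in>Poly_Mapping.keys q. Poly_Mapping.single m (Poly_Mapping.lookup q m)))"
    using sum_single_lookup[of p] sum_single_lookup[of q] by simp
  also have "\<dots> = push_keys f p * push_keys f q"
    by (simp add: sum_product push_keys_sum mult_single push_keys_single assms)
       (simp add: push_keys_def sum_product mult_single)
  finally show ?thesis .
qed

lemma lookup_push_keys:
  "Poly_Mapping.lookup (push_keys f p) x = (\<Sum>m\<in>{m \<in> Poly_Mapping.keys p. f m = x}. Poly_Mapping.lookup p m)"
  by (simp add: push_keys_def lookup_sum lookup_single when_def sum.If_cases Int_def)

lemma keys_push_keys: "Poly_Mapping.keys (push_keys f p) \<subseteq> f ` Poly_Mapping.keys p"
proof
  fix x assume "x \<in> Poly_Mapping.keys (push_keys f p)"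
  then have "{m \<in> Poly_Mapping.keys p. f m = x} \<noteq> {}"
    by (metis in_keys_iff lookup_push_keys sum.empty)
  then show "x \<in> f ` Poly_Mapping.keys p" by auto
qed

section \<open>Ideals in the polynomial ring\<close>

text \<open>Closure under negation comes from multiplication by the constant -1.\<close>

lemma mpol_idealI:
  fixes K :: "('v, 'a::comm_ring_1) mpol set"
  assumes K: "K \<subseteq> carrier (mpol_ring V)" and zero: "0 \<in> K"
    and add: "\<And>p q. p \<in> K \<Longrightarrow> q \<in> K \<Longrightarrow> p + q \<in> K"
    and mult: "\<And>p q. p \<in> carrier (mpol_ring V) \<Longrightarrow> q \<in> K \<Longrightarrow> p * q \<in> K"
  shows "ideal K (mpol_ring V)"
proof -
  interpret cring "mpol_ring V :: ('v, 'a) mpol ring" by (rule cring_mpol_ring)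
  have inv: "\<ominus>\<^bsub>mpol_ring V\<^esub> p \<in> K" if p: "p \<in> K" for p
  proof -
    have "- p \<in> K"
      using mult[OF mpol_carrier_uminus[OF mpol_carrier_one] p] by simp
    moreover have "\<ominus>\<^bsub>mpol_ring V\<^esub> p = - p"
      using p K \<open>- p \<in> K\<close> by (intro minus_equality) (auto simp: mpol_ring_simps(2-))
    ultimately show ?thesis by simp
  qed
  show ?thesis
  proof (rule idealI)
    show "subgroup K (add_monoid (mpol_ring V))"
      using K zero add inv
      by (intro group.subgroupI[OF abelian_group.a_group[OF abelian_group_axioms]])
        (auto simp: a_inv_def mpol_ring_simps(2-))
    show "a \<otimes>\<^bsub>mpol_ring V\<^esub> p \<in> K" if "a \<in> K" "p \<in> carrier (mpol_ring V)" for a p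
      using mult[OF that(2,1)] by (simp add: mpol_ring_simps(2-) mult.commute)
  qed (simp_all add: mult mpol_ring_simps(2-) ring_axioms)
qed

lemma
  fixes K :: "('v, 'a::comm_ring_1) mpol set"
  assumes "ideal K (mpol_ring V)"
  shows mpol_ideal_zero: "0 \<in> K"
    and mpol_ideal_add: "p \<in> K \<Longrightarrow> q \<in> K \<Longrightarrow> p + q \<in> K"
    and mpol_ideal_mult: "p \<in> carrier (mpol_ring V) \<Longrightarrow> q \<in> K \<Longrightarrow> p * q \<in> K"
    and mpol_ideal_uminus: "p \<in> K \<Longrightarrow> - p \<in> K"
proof -
  interpret ideal K "mpol_ring V" by fact
  show "0 \<in> K" "p \<in> K \<Longrightarrow> q \<in> K \<Longrightarrow> p + q \<in> K"
    using additive_subgroup.zero_closed[OF is_additive_subgroup]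
      additive_subgroup.a_closed[OF is_additive_subgroup, of p q]
    by (simp_all add: mpol_ring_simps(2-))
  show mult: "p * q \<in> K" if "p \<in> carrier (mpol_ring V)" "q \<in> K" for p q
    using I_l_closed[of q p] that by (simp add: mpol_ring_simps(2-))
  show "p \<in> K \<Longrightarrow> - p \<in> K"
    using mult[OF mpol_carrier_uminus[OF mpol_carrier_one], of p] by simp
qed

lemma mpol_ideal_sum:
  assumes "ideal K (mpol_ring V)" "\<And>i. i \<in> A \<Longrightarrow> f i \<in> K"
  shows "sum f A \<in> K"
  using assms(2)
  by (induction A rule: infinite_finite_induct)
    (auto simp: mpol_ideal_zero[OF assms(1)] mpol_ideal_add[OF assms(1)])

text \<open>The polynomials whose monomials all contain a variable from \<open>W\<close> form an
  ideal that contains these variables, and the generated ideal is the smallest such ideal.\<close>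

lemma genideal_vars_keys:
  fixes p :: "('v, 'a::comm_ring_1) mpol"
  assumes W: "W \<subseteq> V" and p: "p \<in> genideal (mpol_ring V) (mpol_var ` W)"
    and m: "m \<in> Poly_Mapping.keys p"
  shows "Poly_Mapping.keys m \<inter> W \<noteq> {}"
proof -
  interpret cring "mpol_ring V :: ('v, 'a) mpol ring" by (rule cring_mpol_ring)
  let ?K = "{p :: ('v, 'a) mpol. p \<in> carrier (mpol_ring V) \<and>
    (\<forall>m\<in>Poly_Mapping.keys p. Poly_Mapping.keys m \<inter> W \<noteq> {})}"
  have "ideal ?K (mpol_ring V)"
  proof (rule mpol_idealI)
    fix p q :: "('v, 'a) mpol"
    assume "p \<in> ?K" "q \<in> ?K"
    then show "p + q \<in> ?K"
      using Poly_Mapping.keys_add[of p q] by (auto intro: mpol_carrier_intros)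
  next
    fix p q :: "('v, 'a) mpol"
    assume p: "p \<in> carrier (mpol_ring V)" and q: "q \<in> ?K"
    have "Poly_Mapping.keys m \<inter> W \<noteq> {}" if m: "m \<in> Poly_Mapping.keys (p * q)" for m
    proof -
      obtain a b where ab: "m = a + b" "b \<in> Poly_Mapping.keys q"
        using m keys_mult[of p q] by auto
      moreover have "Poly_Mapping.keys b \<subseteq> Poly_Mapping.keys (a + b)"
        by (auto simp: in_keys_iff lookup_add)
      ultimately show ?thesis using q by auto
    qed
    then show "p * q \<in> ?K" using p q by (auto intro: mpol_carrier_intros)
  qed (auto simp: mpol_carrier_intros)
  moreover have "mpol_var ` W \<subseteq> ?K"
  proof
    fix p :: "('v, 'a) mpol" assume "p \<in> mpol_var ` W"
    then obtain v where "v \<in> W" "p = mpol_var v" by auto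
    then show "p \<in> ?K" using W by (auto simp: mpol_var_def mpol_ring_simps(1))
  qed
  ultimately have "genideal (mpol_ring V) (mpol_var ` W) \<subseteq> ?K"
    by (rule genideal_minimal)
  with p m show ?thesis by auto
qed

section \<open>Types of monomials and overflow\<close>

definition chain_of :: "index \<Rightarrow> nat \<times> nat" where
  "chain_of = (\<lambda>(i1, i2, i3). (i1, i2))"

text \<open>The first variable of a chain has weight 0. Positions in \<open>Lambda\<close> start at
  1, so the truncated subtraction is exact there.\<close>

definition weight :: "index multiset \<Rightarrow> nat" where
  "weight A = (\<Sum>(i1, i2, i3)\<in>#A. i3 - 1)"

text \<open>Types live in a product of additive monoids, so that multiplying monomials adds their
  types and types can serve as exponents themselves.\<close>

definition monom_type :: "(index \<Rightarrow>\<^sub>0 nat) \<Rightarrow> (nat \<times> nat) multiset \<times> nat" where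
  "monom_type m = (image_mset chain_of (mset_of_monom m), weight (mset_of_monom m))"

lemma monom_type_plus: "monom_type (m + n) = monom_type m + monom_type n"
  by (simp add: monom_type_def mset_of_monom_plus weight_def)

text \<open>Some chain of the type is too short to carry the whole weight: position
  \<open>w + 1\<close> lies beyond its end.\<close>

definition overflow :: "(nat \<Rightarrow> nat) \<Rightarrow> (nat \<times> nat) multiset \<times> nat \<Rightarrow> bool" where
  "overflow r = (\<lambda>(M, w). \<exists>c\<in>#M. r (fst c) \<le> w)"

text \<open>Adding \<open>y\<close> keeps the short chain and can only increase the weight. This
  makes the polynomials supported on overflowing types closed under multiplication by arbitrary
  ones.\<close>

lemma overflow_plus: "overflow r x \<Longrightarrow> overflow r (y + x)"
  by (cases x; cases y) (auto simp: overflow_def intro: trans_le_add2)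

text \<open>The two products have the same type and cancel unless a successor is 0. If only
  \<open>u\<close> ends its chain, the surviving product has weight \<open>u3 + v3 - 1\<close>,
  which is at least the length \<open>u3\<close> of that chain because \<open>v3 \<ge> 1\<close>;
  the case of \<open>v\<close> is symmetric.\<close>

lemma push_keys_minor_poly_overflow:
  assumes "u \<in> Lambda l k r" "v \<in> Lambda l k r"
    and "x \<in> Poly_Mapping.keys (push_keys monom_type (minor_poly r u v :: (index, 'a::comm_ring_1) mpol))"
  shows "overflow r x"
proof -
  obtain u1 u2 u3 v1 v2 v3 where uv: "u = (u1, u2, u3)" "v = (v1, v2, v3)" by (cases u, cases v)
  have bounds: "1 \<le> u3" "u3 \<le> r u1" "1 \<le> v3" "v3 \<le> r v1" using assms(1,2) by (auto simp: uv Lambda_def)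
  have push: "push_keys monom_type (mpol_var a * mpol_var b) =
      (Poly_Mapping.single ({#chain_of a, chain_of b#}, weight {#a, b#}) 1 :: _ \<Rightarrow>\<^sub>0 'a)" for a b
    by (simp add: mpol_var_def mult_single push_keys_single monom_type_def mset_of_monom_plus
        mset_of_monom_single add_mset_commute del: One_nat_def)
  show ?thesis
    using assms(3) bounds
    by (auto simp: minor_poly_def next_var_def ext_var_def uv push_keys_diff push chain_of_def weight_def
        overflow_def add_mset_commute add.commute split: if_splits)
qed

section \<open>A necessary condition for membership in the minor ideal\<close>

lemma I_minors_ideal: "ideal (I_minors lam l k r) (R_ring l k r)"
  unfolding I_minors_def
  by (rule ring.genideal_ideal[OF cring.axioms(1)[OF cring_mpol_ring] minors_carrier])

lemma I_minors_carrier: "I_minors lam l k r \<subseteq> carrier (R_ring l k r)"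
  using I_minors_ideal[of lam l k r] by (simp add: additive_subgroup.a_subset ideal.axioms(1))

text \<open>Pushing forward along \<open>monom_type\<close> is multiplicative, so the polynomials
  whose image is supported on overflowing types form an ideal. It contains the minors.\<close>

lemma I_minors_overflow:
  fixes lam :: "'a::comm_ring_1"
  assumes p: "p \<in> I_minors lam l k r" and x: "x \<in> Poly_Mapping.keys (push_keys monom_type p)"
  shows "overflow r x"
proof -
  interpret cring "R_ring l k r :: (index, 'a) mpol ring" by (rule cring_mpol_ring)
  let ?K = "{p :: (index, 'a) mpol. p \<in> carrier (R_ring l k r) \<and>
    (\<forall>x\<in>Poly_Mapping.keys (push_keys monom_type p). overflow r x)}"
  have "ideal ?K (R_ring l k r)"
  proof (rule mpol_idealI)
    fix p q :: "(index, 'a) mpol"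
    assume "p \<in> ?K" "q \<in> ?K"
    then show "p + q \<in> ?K"
      using Poly_Mapping.keys_add[of "push_keys monom_type p" "push_keys monom_type q"]
      by (auto intro: mpol_carrier_intros simp: push_keys_plus)
  next
    fix p q :: "(index, 'a) mpol"
    assume p: "p \<in> carrier (R_ring l k r)" and q: "q \<in> ?K"
    have "overflow r x" if "x \<in> Poly_Mapping.keys (push_keys monom_type (p * q))" for x
    proof -
      have "x \<in> Poly_Mapping.keys (push_keys monom_type p * push_keys monom_type q)"
        using that by (simp only: push_keys_mult[of monom_type, OF monom_type_plus])
      then obtain a b where "x = a + b" "b \<in> Poly_Mapping.keys (push_keys monom_type q)"
        using keys_mult by blast
      then show ?thesis using q overflow_plus by simp
    qed
    then show "p * q \<in> ?K" using p q by (auto intro: mpol_carrier_mult)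
  qed (auto simp: mpol_carrier_intros)
  moreover have "minors 2 (Jx_x lam l k r) \<subseteq> ?K"
  proof
    fix p assume p: "p \<in> minors 2 (Jx_x lam l k r)"
    then obtain i j where ij: "i < j" "j < length (Lambda_list l k r)"
      and "p = minor_poly r (Lambda_list l k r ! i) (Lambda_list l k r ! j)"
      unfolding minors_Jx_x by blast
    moreover have "Lambda_list l k r ! i \<in> Lambda l k r" "Lambda_list l k r ! j \<in> Lambda l k r"
      using ij by (simp_all flip: set_Lambda_list)
    ultimately show "p \<in> ?K"
      using minors_carrier[of 2 lam l k r] p push_keys_minor_poly_overflow by blast
  qed
  ultimately have "I_minors lam l k r \<subseteq> ?K"
    unfolding I_minors_def by (rule genideal_minimal)
  with p x show ?thesis by auto
qed

section \<open>Reduction of monomials modulo the minors\<close>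

lemma minor_poly_in_I_minors:
  fixes lam :: "'a::comm_ring_1"
  assumes "u \<in> Lambda l k r" "v \<in> Lambda l k r"
  shows "minor_poly r u v \<in> I_minors lam l k r"
proof -
  interpret cring "R_ring l k r :: (index, 'a) mpol ring" by (rule cring_mpol_ring)
  have minor: "minor_poly r (Lambda_list l k r ! i) (Lambda_list l k r ! j) \<in> I_minors lam l k r"
    if "i < j" "j < length (Lambda_list l k r)" for i j
  proof -
    have "minor_poly r (Lambda_list l k r ! i) (Lambda_list l k r ! j) \<in> minors 2 (Jx_x lam l k r)"
      using that unfolding minors_Jx_x by blast
    then show ?thesis
      unfolding I_minors_def using genideal_self[OF minors_carrier] by blast
  qed
  obtain i j where ij: "i < length (Lambda_list l k r)" "u = Lambda_list l k r ! i"
    "j < length (Lambda_list l k r)" "v = Lambda_list l k r ! j"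
    using assms unfolding set_Lambda_list[symmetric] in_set_conv_nth by auto
  consider "i < j" | "i = j" | "j < i" by linarith
  then show ?thesis
  proof cases
    case 1
    then show ?thesis using minor ij by simp
  next
    case 2
    then show ?thesis using ij by (simp add: minor_poly_def mpol_ideal_zero[OF I_minors_ideal])
  next
    case 3
    \<comment> \<open>Swapping the two rows changes the sign, which removes the order restriction on
      the row indices.\<close>
    then have "- minor_poly r v u \<in> I_minors lam l k r"
      unfolding ij using minor ij by (intro mpol_ideal_uminus[OF I_minors_ideal]) simp
    then show ?thesis by (simp add: minor_poly_def)
  qed
qed

text \<open>A minor makes \<open>x_c(t) x_b(u+1)\<close> congruent to
  \<open>x_c(t+1) x_b(u)\<close>. Repeating this exchange moves the whole weight of the second
  factor to the chain \<open>c\<close>.\<close>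

lemma I_minors_shift:
  fixes lam :: "'a::comm_ring_1"
  assumes "1 \<le> fst c" "fst c \<le> l" "1 \<le> snd c" "snd c \<le> k (fst c)" "1 \<le> t" "(b1, b2, Suc u) \<in> Lambda l k r"
  shows "ext_var r c t * mpol_var (b1, b2, Suc u) - ext_var r c (t + u) * mpol_var (b1, b2, 1)
    \<in> I_minors lam l k r"
  using assms(5,6)
proof (induction u arbitrary: t)
  case 0
  then show ?case by (simp add: mpol_ideal_zero[OF I_minors_ideal])
next
  case (Suc u)
  have b: "(b1, b2, Suc u) \<in> Lambda l k r" using Suc.prems by (auto simp: Lambda_def)
  have "ext_var r c t * mpol_var (b1, b2, Suc (Suc u)) - ext_var r c (Suc t) * mpol_var (b1, b2, Suc u)
    \<in> I_minors lam l k r"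
  \<comment> \<open>At \<open>t = r (fst c)\<close> the difference is still a minor, its second
    product being 0; for larger \<open>t\<close> both products are 0.\<close>
  proof (cases "t \<le> r (fst c)")
    case True
    then have "(fst c, snd c, t) \<in> Lambda l k r"
      using assms Suc.prems by (auto simp: Lambda_def)
    from minor_poly_in_I_minors[OF b this, of lam] show ?thesis
      using True Suc.prems(2)
      by (simp add: minor_poly_def next_var_def ext_var_def Lambda_def mult.commute cong: if_cong)
  next
    case False
    then show ?thesis by (simp add: ext_var_def mpol_ideal_zero[OF I_minors_ideal])
  qed
  \<comment> \<open>One exchange followed by the induction hypothesis at \<open>Suc t\<close>: the
    middle terms telescope.\<close>
  from mpol_ideal_add[OF I_minors_ideal this Suc.IH[OF _ b, of "Suc t"]] show ?case by simp
qed

text \<open>The factor from the chain \<open>c\<close> absorbs the weights of the variables in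
  \<open>B\<close> one after the other, leaving the first variable of each of their chains.\<close>

lemma I_minors_shift_mset:
  fixes lam :: "'a::comm_ring_1"
  assumes "1 \<le> fst c" "fst c \<le> l" "1 \<le> snd c" "snd c \<le> k (fst c)" "1 \<le> t" "set_mset B \<subseteq> Lambda l k r"
  shows "ext_var r c t * (\<Prod>v\<in>#B. mpol_var v) -
      ext_var r c (t + weight B) * (\<Prod>d\<in>#image_mset chain_of B. mpol_var (fst d, snd d, 1))
    \<in> I_minors lam l k r"
  using assms(5,6)
proof (induction B arbitrary: t)
  case empty
  then show ?case by (simp add: weight_def mpol_ideal_zero[OF I_minors_ideal])
next
  case (add v B)
  obtain b1 b2 b3 where v: "v = (b1, b2, b3)" by (cases v)
  moreover have "v \<in> Lambda l k r" using add.prems by simp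
  ultimately obtain u where "b3 = Suc u" by (cases b3) (auto simp: Lambda_def)
  with v have v: "v = (b1, b2, Suc u)" by simp
  let ?P = "\<Prod>v\<in>#B. mpol_var v :: (index, 'a) mpol" and ?b = "mpol_var (b1, b2, 1) :: (index, 'a) mpol"
  let ?Q = "\<Prod>d\<in>#image_mset chain_of B. mpol_var (fst d, snd d, 1) :: (index, 'a) mpol"
  have "set_mset B \<subseteq> Lambda l k r \<Longrightarrow> ?P \<in> carrier (R_ring l k r)"
    by (induction B) (auto intro: mpol_carrier_intros)
  then have P: "?P \<in> carrier (R_ring l k r)" using add.prems by simp
  have b: "?b \<in> carrier (R_ring l k r)"
    using add.prems by (intro mpol_carrier_var) (auto simp: v Lambda_def)
  \<comment> \<open>The first summand shifts \<open>v\<close> alone; the second is the induction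
    hypothesis started at \<open>t + u\<close>. The two mixed products cancel.\<close>
  have "?P * (ext_var r c t * mpol_var v - ext_var r c (t + u) * ?b) +
    ?b * (ext_var r c (t + u) * ?P - ext_var r c (t + u + weight B) * ?Q) \<in> I_minors lam l k r"
    using add.prems
    by (intro mpol_ideal_add[OF I_minors_ideal] mpol_ideal_mult[OF I_minors_ideal] P b add.IH)
      (auto simp: v intro!: I_minors_shift[unfolded One_nat_def] assms(1-4)[unfolded One_nat_def])
  then show ?case
    by (simp add: v weight_def chain_of_def algebra_simps)
qed

text \<open>The representative with all weight on one occurrence of \<open>c\<close>. Weight
  \<open>w\<close> means position \<open>Suc w\<close>, and \<open>ext_var\<close> makes the
  representative 0 when that position is past the end of \<open>c\<close>.\<close>

definition normal_form ::
    "(nat \<Rightarrow> nat) \<Rightarrow> nat \<times> nat \<Rightarrow> (nat \<times> nat) multiset \<times> nat \<Rightarrow> (index, 'a::comm_ring_1) mpol" where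
  "normal_form r c = (\<lambda>(M, w). ext_var r c (Suc w) * (\<Prod>d\<in>#M - {#c#}. mpol_var (fst d, snd d, 1)))"

text \<open>One variable of the chain \<open>c\<close> is split off from the monomial and absorbs
  the weight of all the others; the outcome depends on \<open>m\<close> only through its
  type.\<close>

lemma monom_normal_form:
  fixes lam :: "'a::comm_ring_1"
  assumes m: "Poly_Mapping.keys m \<subseteq> Lambda l k r" and c: "c \<in># fst (monom_type m)"
  shows "Poly_Mapping.single m 1 - normal_form r c (monom_type m) \<in> I_minors lam l k r"
proof -
  obtain v where v: "v \<in># mset_of_monom m" "chain_of v = c"
    using c by (auto simp: monom_type_def)
  then obtain B where B: "mset_of_monom m = add_mset v B" by (meson multi_member_split)
  obtain t where t: "v = (fst c, snd c, t)" using v(2) by (cases v) (auto simp: chain_of_def)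
  have sub: "set_mset (add_mset v B) \<subseteq> Lambda l k r" using m B set_mset_of_monom[of m] by simp
  then have bounds: "1 \<le> fst c" "fst c \<le> l" "1 \<le> snd c" "snd c \<le> k (fst c)" "1 \<le> t" "t \<le> r (fst c)"
    by (auto simp: t Lambda_def)
  have "normal_form r c (monom_type m) =
    ext_var r c (t + weight B) * (\<Prod>d\<in>#image_mset chain_of B. mpol_var (fst d, snd d, 1) :: (index, 'a) mpol)"
    using bounds(5) v(2) by (simp add: normal_form_def monom_type_def B weight_def t)
  moreover have "Poly_Mapping.single m 1 = ext_var r c t * (\<Prod>v\<in>#B. mpol_var v :: (index, 'a) mpol)"
    using bounds(6) by (simp add: prod_mpol_var[symmetric] B ext_var_def t)
  ultimately show ?thesis
    using I_minors_shift_mset[of c l k t B r lam] bounds sub by simp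
qed

text \<open>Converse of \<open>I_minors_overflow\<close>. Modulo the minors each monomial is
  replaced by a representative of its type; grouped by type, the resulting sum vanishes term by
  term.\<close>

lemma overflow_in_I_minors:
  fixes lam :: "'a::comm_ring_1"
  assumes p: "p \<in> carrier (R_ring l k r)"
    and over: "\<And>x. x \<in> Poly_Mapping.keys (push_keys monom_type p) \<Longrightarrow> overflow r x"
  shows "p \<in> I_minors lam l k r"
proof -
  \<comment> \<open>A single representative for each type, the chain being chosen from the type
    alone. A monomial without chains is the constant one and is represented by 1.\<close>
  define nf :: "(nat \<times> nat) multiset \<times> nat \<Rightarrow> (index, 'a) mpol" where
    "nf x = (if overflow r x then 0 else if fst x = {#} then 1 else normal_form r (SOME c. c \<in># fst x) x)"
    for x
  have nf: "Poly_Mapping.single m 1 - nf (monom_type m) \<in> I_minors lam l k r"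
    if m: "Poly_Mapping.keys m \<subseteq> Lambda l k r" for m
  proof -
    consider (over) "overflow r (monom_type m)" | (empty) "fst (monom_type m) = {#}"
      | (good) "\<not> overflow r (monom_type m)" "fst (monom_type m) \<noteq> {#}" by blast
    then show ?thesis
    proof cases
      case over
      then obtain c where "c \<in># fst (monom_type m)" "r (fst c) \<le> snd (monom_type m)"
        by (auto simp: overflow_def split: prod.splits)
      with monom_normal_form[OF m, of c lam] over show ?thesis
        by (auto simp: nf_def normal_form_def ext_var_def split: prod.splits)
    next
      case empty
      then have "Poly_Mapping.keys m = {}"
        by (simp add: monom_type_def flip: set_mset_of_monom)
      then show ?thesis
        using empty by (auto simp: nf_def overflow_def mpol_ideal_zero[OF I_minors_ideal] split: prod.splits)
    next
      case good
      then have "(SOME c. c \<in># fst (monom_type m)) \<in># fst (monom_type m)"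
        by (metis multiset_nonemptyE someI_ex)
      with monom_normal_form[OF m this, of lam] good show ?thesis by (simp add: nf_def)
    qed
  qed
  let ?K = "Poly_Mapping.keys p"
  have "(\<Sum>m\<in>?K. mpol_const (Poly_Mapping.lookup p m) * nf (monom_type m)) =
      (\<Sum>x\<in>monom_type ` ?K. \<Sum>m\<in>{m\<in>?K. monom_type m = x}.
        mpol_const (Poly_Mapping.lookup p m) * nf (monom_type m))"
    by (rule sum.image_gen) simp
  also have "\<dots> = (\<Sum>x\<in>monom_type ` ?K.
      mpol_const (Poly_Mapping.lookup (push_keys monom_type p) x) * nf x)"
  proof (rule sum.cong)
    fix x
    have const: "mpol_const (sum f A) = (\<Sum>a\<in>A. mpol_const (f a) :: (index, 'a) mpol)"
      for f and A :: "(index \<Rightarrow>\<^sub>0 nat) set"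
      by (induction A rule: infinite_finite_induct) (simp_all add: mpol_const_def single_add)
    show "(\<Sum>m\<in>{m\<in>?K. monom_type m = x}. mpol_const (Poly_Mapping.lookup p m) * nf (monom_type m)) =
        mpol_const (Poly_Mapping.lookup (push_keys monom_type p) x) * nf x"
      by (simp add: lookup_push_keys const sum_distrib_right)
  qed simp
  also have "\<dots> = 0"
  \<comment> \<open>Outside the support of the pushforward the coefficient is 0; on the support the
    type overflows and \<open>nf\<close> is 0.\<close>
  proof (rule sum.neutral, rule ballI)
    fix x
    show "mpol_const (Poly_Mapping.lookup (push_keys monom_type p) x) * nf x = 0"
      using over[of x] by (cases "x \<in> Poly_Mapping.keys (push_keys monom_type p)")
        (simp_all add: nf_def mpol_const_def in_keys_iff)
  qed
  \<comment> \<open>Since the sum of the representatives is 0, subtracting it does not change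
    \<open>p\<close>, and each term of the difference lies in the ideal.\<close>
  finally have "(\<Sum>m\<in>?K. mpol_const (Poly_Mapping.lookup p m) *
      (Poly_Mapping.single m 1 - nf (monom_type m))) = p"
    by (subst (2) sum_single_lookup)
      (simp add: right_diff_distrib sum_subtractf mpol_const_def mult_single)
  moreover have "(\<Sum>m\<in>?K. mpol_const (Poly_Mapping.lookup p m) *
      (Poly_Mapping.single m 1 - nf (monom_type m))) \<in> I_minors lam l k r"
    using p by (intro mpol_ideal_sum[OF I_minors_ideal] mpol_ideal_mult[OF I_minors_ideal]
        mpol_carrier_const nf) (auto simp: mpol_ring_simps(1))
  ultimately show ?thesis by simp
qed

section \<open>The variable ideals and the intersection\<close>

lemma I_vars_ideal: "ideal (I_vars l k r j) (R_ring l k r)"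
  unfolding I_vars_def
  by (rule ring.genideal_ideal[OF cring.axioms(1)[OF cring_mpol_ring] vars_carrier])

text \<open>Some monomial of this type occurs in \<open>p\<close> and contains a generator. A
  variable from \<open>Lambda1\<close> has position at least \<open>r j + 1\<close> and alone
  contributes weight at least \<open>r j\<close>; one from \<open>Lambda2\<close> lies in a chain of
  block index above \<open>j\<close>.\<close>

lemma I_vars_monom_type:
  fixes p :: "(index, 'a::comm_ring_1) mpol"
  assumes p: "p \<in> I_vars l k r j" and x: "(M, w) \<in> Poly_Mapping.keys (push_keys monom_type p)"
  shows "\<exists>c\<in>#M. fst c > j \<or> r j \<le> w"
proof -
  obtain m where m: "m \<in> Poly_Mapping.keys p" "monom_type m = (M, w)"
    using subsetD[OF keys_push_keys x] by (metis imageE)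
  have "Lambda1 l k r j \<union> Lambda2 l k r j \<subseteq> Lambda l k r"
    by (auto simp: Lambda1_def Lambda2_def)
  from genideal_vars_keys[OF this p[unfolded I_vars_def] m(1)]
  obtain v where v: "v \<in> Poly_Mapping.keys m" "v \<in> Lambda1 l k r j \<union> Lambda2 l k r j" by auto
  then have "v \<in># mset_of_monom m" by (simp add: set_mset_of_monom)
  then obtain B where B: "mset_of_monom m = add_mset v B" by (meson multi_member_split)
  have "chain_of v \<in># M" "snd (snd v) - 1 \<le> w"
    using m(2) B by (auto simp: monom_type_def weight_def split: prod.splits)
  then show ?thesis
    using v(2) by (intro bexI[of _ "chain_of v"]) (auto simp: Lambda1_def Lambda2_def chain_of_def)
qed

theorem proposition3p13:
  fixes lam :: "'a::field" and l :: nat and k r :: "nat \<Rightarrow> nat"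
  assumes "l \<ge> 1"
    and "\<And>i. 1 \<le> i \<Longrightarrow> i \<le> l \<Longrightarrow> k i > 0"
    and "\<And>i. 1 \<le> i \<Longrightarrow> i \<le> l \<Longrightarrow> r i > 0"
    and "\<And>i j. 1 \<le> i \<Longrightarrow> i < j \<Longrightarrow> j \<le> l \<Longrightarrow> r i > r j"
  shows "I_minors lam l k r = (\<Inter>j\<in>{1..l}. q_ideal lam l k r j)"
proof (intro equalityI subsetI)
  fix p assume "p \<in> I_minors lam l k r"
  moreover have "0 \<in> I_vars l k r j" for j
    by (rule mpol_ideal_zero[OF I_vars_ideal])
  ultimately show "p \<in> (\<Inter>j\<in>{1..l}. q_ideal lam l k r j)"
    by (force simp: q_ideal_def set_add_def' mpol_ring_simps(2-))
next
  fix p assume "p \<in> (\<Inter>j\<in>{1..l}. q_ideal lam l k r j)"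
  then have q: "\<exists>g\<in>I_minors lam l k r. \<exists>h\<in>I_vars l k r j. p = g + h" if "1 \<le> j" "j \<le> l" for j
    using that by (force simp: q_ideal_def set_add_def' mpol_ring_simps(2-))
  have p: "p \<in> carrier (R_ring l k r)"
  proof -
    have "I_vars l k r 1 \<subseteq> carrier (R_ring l k r)"
      by (intro additive_subgroup.a_subset ideal.axioms(1) I_vars_ideal)
    then show ?thesis
      using q[of 1] assms(1) I_minors_carrier[of lam l k r] by (auto intro: mpol_carrier_add)
  qed
  show "p \<in> I_minors lam l k r"
  proof (rule overflow_in_I_minors[OF p])
    fix x assume x: "x \<in> Poly_Mapping.keys (push_keys monom_type p)"
    obtain M w where Mw: "x = (M, w)" by (cases x)
    obtain m where m: "m \<in> Poly_Mapping.keys p" "monom_type m = x"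
      using subsetD[OF keys_push_keys x] by (metis imageE)
    have "Poly_Mapping.keys m \<subseteq> Lambda l k r"
      using p m(1) by (auto simp: mpol_ring_simps(1))
    then have "chain_of v \<in> {1..l} \<times> UNIV" if "v \<in> Poly_Mapping.keys m" for v
      using that by (auto simp: chain_of_def Lambda_def)
    then have M: "1 \<le> fst c" "fst c \<le> l" if "c \<in># M" for c
      using m(2) that by (fastforce simp: Mw monom_type_def set_mset_of_monom)+
    \<comment> \<open>The largest block index in \<open>M\<close>; inserting 1 yields a legal index
      also for empty \<open>M\<close>.\<close>
    define j where "j = Max (insert 1 (fst ` set_mset M))"
    have "1 \<le> j" "j \<le> l"
      unfolding j_def using M assms(1) by auto
    then obtain g h where gh: "g \<in> I_minors lam l k r" "h \<in> I_vars l k r j" "p = g + h"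
      using q by blast
    then have "x \<in> Poly_Mapping.keys (push_keys monom_type g) \<or> x \<in> Poly_Mapping.keys (push_keys monom_type h)"
      using x Poly_Mapping.keys_add[of "push_keys monom_type g" "push_keys monom_type h"]
      by (auto simp: push_keys_plus)
    then show "overflow r x"
    proof
      assume "x \<in> Poly_Mapping.keys (push_keys monom_type g)"
      then show ?thesis by (rule I_minors_overflow[OF gh(1)])
    next
      assume "x \<in> Poly_Mapping.keys (push_keys monom_type h)"
      then obtain c where c: "c \<in># M" "fst c > j \<or> r j \<le> w"
        using I_vars_monom_type[OF gh(2)] Mw by blast
      \<comment> \<open>By maximality no chain of \<open>M\<close> has block index above
        \<open>j\<close>, so the alternative about the weight must hold.\<close>
      have "fst c \<le> j" using c(1) unfolding j_def by (intro Max_ge) auto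
      then have "r j \<le> w" using c(2) by simp
      \<comment> \<open>The maximum is attained in \<open>M\<close> and is not merely the inserted
        1: if \<open>j = 1\<close>, then \<open>c\<close> itself has block index 1. Hence
        \<open>M\<close> contains a chain of length \<open>r j \<le> w\<close>.\<close>
      moreover have "j \<in> fst ` set_mset M"
      proof -
        have "j \<in> insert 1 (fst ` set_mset M)" unfolding j_def by (intro Max_in) auto
        moreover have "1 \<in> fst ` set_mset M" if "j = 1"
          using M(1)[OF c(1)] \<open>fst c \<le> j\<close> c(1) that by force
        ultimately show ?thesis by auto
      qed
      ultimately show ?thesis by (auto simp: overflow_def Mw)
    qed
  qed
qed

end
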